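(* Let $f:\mathbb{R}^d\to\mathbb{R}$ be a continuously differentiable convex function whose gradient satisfies $\|\nabla f(x)-\nabla f(y)\|\le L\|x-y\|$ for all $x,y\in\mathbb{R}^d$, with $L>0$. Assume that the set $S:=\arg\min_{x\in\mathbb{R}^d} f(x)$ is nonempty and that the minimum value $f_*:=\min_{x\in\mathbb{R}^d} f(x)$ is known. Let $\{x_k\}$ be the sequence determined by the adaptive heavy ball method (AHB) with parameters $\beta\in(0,\infty]$ and $0\le\mu_0<1$. Then there exists $x^\dag\in S$ such that $$\|x_k - x^\dag\| \to 0 \quad \text{as } k \to \infty.$$ If, in addition, there exist constants $\kappa>0$ and $\alpha \ge 2$ such that $$\kappa [d(x, S)]^\alpha \le f(x) - f_*, \quad \forall x \in B_R(x^\dag),$$ where $R$ is a number such that $\|x_k - x^\dag\| < R$ for all $k \ge 0$, then the following convergence rates hold: (i) If $\alpha = 2$, then $\{x_k\}$ converges to $x^\dag$ linearly, i.e. $$\|x_{k+1} - x^\dag\|^2 \le \left(1 - \frac{(1-\mu_0^2)\kappa}{4L} \right) \|x_k - x^\dag\|^2, \quad \forall k \ge 0.$$ (ii) If $\alpha >2$, then there exists a positive constant $C$ independent of $k$ such that $$\|x_k - x^\dag\| \le C (k+1)^{-\frac{1}{\alpha-2}}, \quad \forall k \ge 0.$$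
   Context: $d(x,S):=\inf_{z\in S}\|x-z\|$ and $B_R(x^\dag)$ is the open ball of radius $R$ centered at $x^\dag$. Adaptive heavy ball method (AHB): take an initial guess $x_0\in\mathbb{R}^d$ and set $x_{-1}=x_0$. Pick $\beta\in(0,\infty]$ and $0\le\mu_0<1$. For $k\ge 0$ do the following. (i) Set $g_k:=\nabla f(x_k)$ and $\alpha_k:=\frac{1+\mu_0}{L}$. (ii) Set $m_k:=x_k-x_{k-1}$ and $$\tilde\gamma_k=\begin{cases}0 & \text{if } k=0,\\ \|m_k\|^2-\alpha_{k-1}\left(f(x_{k-1})-f_*+\frac{1}{2L}\|g_{k-1}\|^2\right)+\beta_{k-1}\tilde\gamma_{k-1} & \text{if } k\ge1.\end{cases}$$ (iii) Set $$\beta_k=\begin{cases}\min\left\{\max\left\{0,\frac{\alpha_k\langle g_k,m_k\rangle-\tilde\gamma_k}{\|m_k\|^2}\right\},\beta\right\} & \text{if } m_k\ne0,\\ 0 & \text{if } m_k=0.\end{cases}$$ (iv) Set $x_{k+1}=x_k-\alpha_k g_k+\beta_k m_k$. (The constant exponent $\alpha$ in the claim is unrelated to the step-sizes $\alpha_k$.) *)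

theory Defs
  imports "HOL-Analysis.Analysis"
begin

text \<open>
  The adaptive heavy ball method for an objective \<open>f\<close> with gradient \<open>g\<close>, gradient Lipschitz
  constant \<open>L\<close>, minimum value \<open>f_star\<close>, parameters \<open>\<mu>0\<close> and \<open>\<beta>\<close>, and initial guess \<open>x0\<close>.
  The cap \<open>\<beta>\<close> is an extended real, so that \<open>\<beta> = \<infinity>\<close> (no cap) is allowed.

  The convention \<open>x\<^sub>-\<^sub>1 = x\<^sub>0\<close> is encoded by truncated subtraction: for \<open>k = 0\<close> the term
  \<open>ahb_x (k - 1)\<close> is \<open>ahb_x 0\<close>.
\<close>

context
  fixes f :: "'a::real_inner \<Rightarrow> real" and g :: "'a \<Rightarrow> 'a" and L f_star \<mu>0 :: real
    and \<beta> :: ereal and x0 :: 'a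
begin

definition ahb_alpha :: "nat \<Rightarrow> real" where
  "ahb_alpha k = (1 + \<mu>0) / L"

fun ahb_x :: "nat \<Rightarrow> 'a"
  and ahb_m :: "nat \<Rightarrow> 'a"
  and ahb_gamma :: "nat \<Rightarrow> real"
  and ahb_beta :: "nat \<Rightarrow> real"
where
  "ahb_x 0 = x0"
| "ahb_x (Suc k) = ahb_x k - ahb_alpha k *\<^sub>R g (ahb_x k) + ahb_beta k *\<^sub>R ahb_m k"
| "ahb_m k = ahb_x k - ahb_x (k - 1)"
| "ahb_gamma 0 = 0"
| "ahb_gamma (Suc k) =
     (norm (ahb_m (Suc k)))\<^sup>2
     - ahb_alpha k * (f (ahb_x k) - f_star + 1 / (2 * L) * (norm (g (ahb_x k)))\<^sup>2)
     + ahb_beta k * ahb_gamma k"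
| "ahb_beta k =
     (if ahb_m k \<noteq> 0
      then real_of_ereal
             (min (ereal (max 0 ((ahb_alpha k * (g (ahb_x k) \<bullet> ahb_m k) - ahb_gamma k)
                                 / (norm (ahb_m k))\<^sup>2)))
                  \<beta>)
      else 0)"

end

end

theory Submission
  imports Defs
begin

text \<open>
  The coefficient \<open>\<beta>\<^sub>k\<close> is chosen to make one step contract towards every minimizer \<open>z\<close> at
  once. Expanding \<open>\<parallel>x\<^sub>k\<^sub>+\<^sub>1 - z\<parallel>\<^sup>2\<close> produces the term \<open>2\<beta>\<^sub>k\<langle>m\<^sub>k, x\<^sub>k - z\<rangle>\<close>, which involves the unknown \<open>z\<close>.
  Cocoercivity of the gradient, applied at all earlier iterates, bounds \<open>\<langle>m\<^sub>k, x\<^sub>k - z\<rangle>\<close> by the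
  computable number \<open>\<gamma>\<^sub>k\<close> (lemma \<open>momentum_inner_le_gamma\<close>). After this replacement the part of the
  expansion that depends on \<open>\<beta>\<^sub>k\<close> is a quadratic vanishing at \<open>0\<close>, and \<open>\<beta>\<^sub>k\<close> lies between \<open>0\<close> and the
  minimizer of that quadratic over the nonnegative reals, so momentum never hurts. What is left is the
  estimate of a plain gradient step (lemma \<open>sq_dist_decrease\<close>)
  \[ \|x_{k+1} - z\|^2 \le \|x_k - z\|^2 - \frac{2 (1-\mu_0^2)}{L} (f(x_k) - f_*) . \]

  Hence the values tend to \<open>f\<^sub>*\<close>, and the iterates are Fejer monotone with respect to the solution set \<open>S\<close>. A
  cluster point lies in \<open>S\<close>, and Fejer monotonicity makes the whole sequence converge to it, say
  to \<open>x\<^sup>\<dagger>\<close>. The same monotonicity gives \<open>\<parallel>x\<^sub>k - x\<^sup>\<dagger>\<parallel> \<le> 2 d(x\<^sub>k, S)\<close> (lemma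
  \<open>fejer_dist_limit_le\<close>): an error bound in terms of \<open>d(x\<^sub>k, S)\<close> therefore
  controls the distance to the limit itself. Writing \<open>D\<^sub>k = \<parallel>x\<^sub>k - x\<^sup>\<dagger>\<parallel>\<^sup>2\<close>, the displayed estimate
  becomes \<open>D\<^sub>k\<^sub>+\<^sub>1 \<le> D\<^sub>k - q D\<^sub>k\<^bsup>\<alpha>/2\<^esup>\<close> with a constant \<open>q > 0\<close>. This is linear contraction for
  \<open>\<alpha> = 2\<close>; for \<open>\<alpha> > 2\<close> the quantity \<open>D\<^sub>k\<close> raised to the power \<open>1 - \<alpha>/2 < 0\<close> grows at least linearly
  in \<open>k\<close> (lemma \<open>power_decrease_rate\<close>).
\<close>

section \<open>Convex functions with Lipschitz gradient\<close>

locale smooth_convex =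
  fixes f :: "'a::real_inner \<Rightarrow> real" and g :: "'a \<Rightarrow> 'a" and L :: real
  assumes convex: "convex_on UNIV f"
    and gradient: "\<And>y. GDERIV f y :> g y"
    and L_pos: "L > 0"
    and lipschitz: "\<And>y z. norm (g y - g z) \<le> L * norm (y - z)"
begin

lemma deriv_along_line:
  "((\<lambda>t. f (x + t *\<^sub>R d)) has_real_derivative g (x + t *\<^sub>R d) \<bullet> d) (at t)"
proof -
  have f': "(f has_derivative (\<lambda>h. h \<bullet> g (x + t *\<^sub>R d))) (at (x + t *\<^sub>R d))"
    using gradient by (simp add: gderiv_def inner_commute)
  have "((\<lambda>t. x + t *\<^sub>R d) has_derivative (\<lambda>h. h *\<^sub>R d)) (at t)"
    by (auto intro!: derivative_eq_intros)
  then have "((\<lambda>t. f (x + t *\<^sub>R d)) has_derivative (\<lambda>h. (h *\<^sub>R d) \<bullet> g (x + t *\<^sub>R d))) (at t)"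
    by (rule has_derivative_compose) (use f' in simp)
  then show ?thesis
    unfolding has_field_derivative_def
    by (rule has_derivative_eq_rhs) (simp add: fun_eq_iff inner_commute)
qed

lemma tangent_below: "f x + g x \<bullet> (y - x) \<le> f y"
proof -
  define h where "h t = f (x + t *\<^sub>R (y - x))" for t
  have "convex_on UNIV h"
  proof (rule convex_onI)
    fix t u v :: real assume t: "0 < t" "t < 1"
    have "x + ((1 - t) *\<^sub>R u + t *\<^sub>R v) *\<^sub>R (y - x)
        = (1 - t) *\<^sub>R (x + u *\<^sub>R (y - x)) + t *\<^sub>R (x + v *\<^sub>R (y - x))"
      by (simp add: algebra_simps)
    then show "h ((1 - t) *\<^sub>R u + t *\<^sub>R v) \<le> (1 - t) * h u + t * h v"
      unfolding h_def using convex_onD[OF convex, of t] t by simp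
  qed simp
  moreover have "(h has_real_derivative g x \<bullet> (y - x)) (at 0)"
    using deriv_along_line[of x "y - x" 0] by (simp add: h_def[abs_def])
  ultimately have "h 1 - h 0 \<ge> (g x \<bullet> (y - x)) * (1 - 0)"
    by (intro convex_on_imp_above_tangent[where A = UNIV]) auto
  then show ?thesis by (simp add: h_def)
qed

lemma descent: "f y \<le> f x + g x \<bullet> (y - x) + L / 2 * (norm (y - x))\<^sup>2"
proof -
  define d where "d = y - x"
  define h where "h t = f (x + t *\<^sub>R d) - t * (g x \<bullet> d) - L / 2 * t\<^sup>2 * (norm d)\<^sup>2" for t
  have "h 1 \<le> h 0"
  proof (rule DERIV_nonpos_imp_nonincreasing[where f = h and a = 0 and b = 1])
    fix t :: real assume t: "0 \<le> t"
    have "(h has_real_derivative g (x + t *\<^sub>R d) \<bullet> d - g x \<bullet> d - L * t * (norm d)\<^sup>2) (at t)"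
      unfolding h_def by (auto intro!: derivative_eq_intros deriv_along_line)
    moreover have "g (x + t *\<^sub>R d) \<bullet> d - g x \<bullet> d \<le> L * t * (norm d)\<^sup>2"
    proof -
      have "(g (x + t *\<^sub>R d) - g x) \<bullet> d \<le> norm (g (x + t *\<^sub>R d) - g x) * norm d"
        by (rule norm_cauchy_schwarz)
      also have "\<dots> \<le> (L * norm (x + t *\<^sub>R d - x)) * norm d"
        by (intro mult_right_mono lipschitz) simp
      finally show ?thesis
        using t by (simp add: inner_diff_left power2_eq_square mult.assoc)
    qed
    ultimately show "\<exists>D. (h has_real_derivative D) (at t) \<and> D \<le> 0" by force
  qed simp
  then show ?thesis by (simp add: h_def d_def)
qed

text \<open>The tangent plane at \<open>x\<close> lies below \<open>f\<close> at the point reached from \<open>y\<close> by a step of size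
  \<open>1/L\<close> along \<open>g x - g y\<close>; the descent estimate bounds \<open>f\<close> at that point from above.\<close>

lemma cocoercive: "f x + g x \<bullet> (y - x) + (norm (g y - g x))\<^sup>2 / (2 * L) \<le> f y"
proof -
  define e where "e = g y - g x"
  define z where "z = y - (1 / L) *\<^sub>R e"
  have "f x + g x \<bullet> (z - x) \<le> f y + g y \<bullet> (z - y) + L / 2 * (norm (z - y))\<^sup>2"
    using tangent_below[of x z] descent[of z y] by linarith
  moreover have "g x \<bullet> (z - x) = g x \<bullet> (y - x) - (g x \<bullet> e) / L"
    by (simp add: z_def inner_diff_right)
  moreover have "g y \<bullet> (z - y) = - (g x \<bullet> e) / L - (norm e)\<^sup>2 / L"
    by (simp add: z_def power2_norm_eq_inner e_def inner_diff_left inner_diff_right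
        diff_divide_distrib add_divide_distrib inner_commute)
  moreover have "L / 2 * (norm (z - y))\<^sup>2 = (norm e)\<^sup>2 / (2 * L)"
    using L_pos by (simp add: z_def power_divide power2_eq_square)
  moreover have "(norm e)\<^sup>2 / L = 2 * ((norm e)\<^sup>2 / (2 * L))" by simp
  ultimately show ?thesis unfolding e_def[symmetric] by linarith
qed

lemma gradient_zero_at_min:
  assumes "\<And>y. f z \<le> f y"
  shows "g z = 0"
proof -
  have "f z \<le> f z - (norm (g z))\<^sup>2 / L + L / 2 * (norm ((1 / L) *\<^sub>R g z))\<^sup>2"
    using descent[of "z - (1 / L) *\<^sub>R g z" z] assms[of "z - (1 / L) *\<^sub>R g z"]
    by (simp add: power2_norm_eq_inner)
  also have "L / 2 * (norm ((1 / L) *\<^sub>R g z))\<^sup>2 = (norm (g z))\<^sup>2 / L / 2"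
    using L_pos by (simp add: power_divide power2_eq_square)
  finally have "(norm (g z))\<^sup>2 / L \<le> 0" by simp
  then show ?thesis
    using L_pos by (simp add: divide_le_0_iff power2_eq_square mult_le_0_iff)
qed

lemma cont_f: "isCont f y"
  using gradient unfolding gderiv_def by (rule has_derivative_continuous)

end

section \<open>One step of the adaptive heavy ball method\<close>

text \<open>Unfolding the mutually recursive equations during simplification multiplies the size of goals, so
  they are only used to derive the recursions below.\<close>

declare ahb_x.simps [simp del] ahb_m.simps [simp del] ahb_gamma.simps [simp del]
  ahb_beta.simps [simp del]

lemma capped_coefficient_bounds:
  assumes "0 \<le> t" and "0 < (\<beta> :: ereal)"
  shows "0 \<le> real_of_ereal (min (ereal t) \<beta>)" and "real_of_ereal (min (ereal t) \<beta>) \<le> t"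
  using assms by (cases \<beta>; auto simp: min_def)+

locale adaptive_heavy_ball = smooth_convex f g L
  for f :: "'a::real_inner \<Rightarrow> real" and g :: "'a \<Rightarrow> 'a" and L :: real +
  fixes f_star \<mu> :: real and \<beta> :: ereal and x0 :: 'a
  assumes f_star_le: "\<And>y. f_star \<le> f y"
    and beta_pos: "0 < \<beta>"
    and mu_nonneg: "0 \<le> \<mu>" and mu_less_1: "\<mu> < 1"
begin

abbreviation "X \<equiv> ahb_x f g L f_star \<mu> \<beta> x0"
abbreviation "m \<equiv> ahb_m f g L f_star \<mu> \<beta> x0"
abbreviation "\<gamma> \<equiv> ahb_gamma f g L f_star \<mu> \<beta> x0"
abbreviation "b \<equiv> ahb_beta f g L f_star \<mu> \<beta> x0"
abbreviation "a \<equiv> (1 + \<mu>) / L"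

definition "rate = 2 * (1 - \<mu>\<^sup>2) / L"

lemma a_pos: "a > 0"
  using mu_nonneg L_pos by simp

lemma rate_pos: "rate > 0"
  using mu_nonneg mu_less_1 L_pos by (simp add: rate_def power_less_one_iff)

lemma step: "X (Suc k) = X k + m (Suc k)"
  by (simp add: ahb_m.simps)

lemma momentum_Suc: "m (Suc k) = b k *\<^sub>R m k - a *\<^sub>R g (X k)"
  unfolding ahb_m.simps[of _ _ _ _ _ _ _ "Suc k"] ahb_x.simps(2) ahb_alpha_def by simp

lemma gamma_Suc:
  "\<gamma> (Suc k) = (norm (m (Suc k)))\<^sup>2
     - a * (f (X k) - f_star + (norm (g (X k)))\<^sup>2 / (2 * L)) + b k * \<gamma> k"
  unfolding ahb_gamma.simps(2) ahb_alpha_def by simp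

lemma coefficient_nonneg: "0 \<le> b k"
  unfolding ahb_beta.simps
  by (simp only: capped_coefficient_bounds(1)[OF max.cobounded1 beta_pos] order.refl split: if_split)
     simp

text \<open>The quadratic \<open>s \<mapsto> s\<^sup>2\<parallel>m\<^sub>k\<parallel>\<^sup>2 - 2s(a\<langle>g\<^sub>k, m\<^sub>k\<rangle> - \<gamma>\<^sub>k)\<close> is convex and vanishes at \<open>0\<close>; the coefficient
  lies between \<open>0\<close> and the minimizer of this quadratic over the nonnegative reals.\<close>

lemma momentum_quadratic_nonpos:
  "(b k)\<^sup>2 * (norm (m k))\<^sup>2 - 2 * b k * (a * (g (X k) \<bullet> m k) - \<gamma> k) \<le> 0"
proof (cases "m k = 0")
  case True
  then have "b k = 0" by (simp add: ahb_beta.simps)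
  then show ?thesis by simp
next
  case False
  define M where "M = (norm (m k))\<^sup>2"
  define q where "q = a * (g (X k) \<bullet> m k) - \<gamma> k"
  have M: "M > 0" using False by (simp add: M_def)
  have b: "b k = real_of_ereal (min (ereal (max 0 (q / M))) \<beta>)"
    unfolding ahb_beta.simps M_def q_def ahb_alpha_def using False by simp
  have b0: "0 \<le> b k" and bq: "b k \<le> max 0 (q / M)"
    unfolding b by (intro capped_coefficient_bounds beta_pos max.cobounded1)+
  have "b k * (b k * M) \<le> b k * (2 * q)"
  proof (cases "b k = 0")
    case False
    then have "b k \<le> q / M" using b0 bq by (simp add: max_def split: if_splits)
    then have "b k * M \<le> q" using M by (simp add: pos_le_divide_eq)
    moreover have "0 \<le> b k * M" using b0 M by (metis less_imp_le mult_nonneg_nonneg)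
    ultimately show ?thesis using b0 by (intro mult_left_mono) linarith+
  qed simp
  then show ?thesis
    unfolding M_def[symmetric] q_def[symmetric]
    by (simp add: power2_eq_square algebra_simps)
qed

context
  fixes z :: 'a
  assumes z: "f z = f_star"
begin

lemma gradient_at_solution: "g z = 0"
  using gradient_zero_at_min[of z] f_star_le z by simp

lemma gradient_inner_ge:
  "f (X k) - f_star + (norm (g (X k)))\<^sup>2 / (2 * L) \<le> g (X k) \<bullet> (X k - z)"
  using cocoercive[of "X k" z] z gradient_at_solution
  by (simp add: inner_diff_right)

text \<open>The recursion for \<open>\<gamma>\<close> imitates the exact recursion
  \<open>\<langle>m\<^sub>k\<^sub>+\<^sub>1, x\<^sub>k\<^sub>+\<^sub>1 - z\<rangle> = \<parallel>m\<^sub>k\<^sub>+\<^sub>1\<parallel>\<^sup>2 - a\<langle>g\<^sub>k, x\<^sub>k - z\<rangle> + \<beta>\<^sub>k\<langle>m\<^sub>k, x\<^sub>k - z\<rangle>\<close>, with the middle inner product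
  replaced by its lower bound from cocoercivity; \<open>\<beta>\<^sub>k \<ge> 0\<close> carries the bound on.\<close>

lemma momentum_inner_le_gamma: "m k \<bullet> (X k - z) \<le> \<gamma> k"
proof (induction k)
  case 0
  show ?case by (simp add: ahb_m.simps ahb_gamma.simps)
next
  case (Suc k)
  have "m (Suc k) \<bullet> (X (Suc k) - z) = (norm (m (Suc k)))\<^sup>2 + m (Suc k) \<bullet> (X k - z)"
    unfolding step by (simp add: power2_norm_eq_inner inner_diff_right inner_add_right)
  moreover have "m (Suc k) \<bullet> (X k - z) = b k * (m k \<bullet> (X k - z)) - a * (g (X k) \<bullet> (X k - z))"
    unfolding momentum_Suc by (simp add: inner_diff_left)
  moreover have "b k * (m k \<bullet> (X k - z)) \<le> b k * \<gamma> k"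
    by (rule mult_left_mono[OF Suc.IH coefficient_nonneg])
  moreover have "a * (f (X k) - f_star + (norm (g (X k)))\<^sup>2 / (2 * L)) \<le> a * (g (X k) \<bullet> (X k - z))"
    by (rule mult_left_mono[OF gradient_inner_ge less_imp_le[OF a_pos]])
  ultimately show ?case unfolding gamma_Suc by linarith
qed

lemma sq_dist_decrease:
  "(norm (X (Suc k) - z))\<^sup>2 \<le> (norm (X k - z))\<^sup>2 - rate * (f (X k) - f_star)"
proof -
  define G where "G = (norm (g (X k)))\<^sup>2"
  define F where "F = f (X k) - f_star"
  define P where "P = g (X k) \<bullet> m k"
  define M where "M = (norm (m k))\<^sup>2"
  have expand: "(norm (X (Suc k) - z))\<^sup>2
      = (norm (X k - z))\<^sup>2 + 2 * (b k * (m k \<bullet> (X k - z)) - a * (g (X k) \<bullet> (X k - z)))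
        + ((b k)\<^sup>2 * M - 2 * b k * (a * P) + a\<^sup>2 * G)"
  proof -
    have "(norm (X (Suc k) - z))\<^sup>2
        = (norm (X k - z))\<^sup>2 + 2 * (m (Suc k) \<bullet> (X k - z)) + (norm (m (Suc k)))\<^sup>2"
      unfolding step by (simp add: power2_norm_eq_inner inner_diff_right inner_add_right
          inner_diff_left inner_add_left inner_commute algebra_simps)
    moreover have "m (Suc k) \<bullet> (X k - z) = b k * (m k \<bullet> (X k - z)) - a * (g (X k) \<bullet> (X k - z))"
      unfolding momentum_Suc by (simp add: inner_diff_left)
    moreover have "(norm (m (Suc k)))\<^sup>2 = (b k)\<^sup>2 * M - 2 * b k * (a * P) + a\<^sup>2 * G"
    proof -
      have "(norm (s *\<^sub>R u - t *\<^sub>R v))\<^sup>2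
          = s\<^sup>2 * (norm u)\<^sup>2 - 2 * s * (t * (v \<bullet> u)) + t\<^sup>2 * (norm v)\<^sup>2" for s t and u v :: 'a
        unfolding power2_norm_eq_inner
        by (simp add: inner_diff_left inner_diff_right inner_commute power2_eq_square)
      then show ?thesis unfolding momentum_Suc M_def P_def G_def .
    qed
    ultimately show ?thesis by (simp only:)
  qed
  have 1: "b k * (m k \<bullet> (X k - z)) \<le> b k * \<gamma> k"
    by (rule mult_left_mono[OF momentum_inner_le_gamma coefficient_nonneg])
  have 2: "a * (F + G / (2 * L)) \<le> a * (g (X k) \<bullet> (X k - z))"
    unfolding F_def G_def by (rule mult_left_mono[OF gradient_inner_ge less_imp_le[OF a_pos]])
  have 3: "(b k)\<^sup>2 * M - 2 * b k * (a * P) + 2 * (b k * \<gamma> k) \<le> 0"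
    using momentum_quadratic_nonpos[of k] unfolding M_def P_def
    by (simp add: right_diff_distrib)
  have "G / (2 * L) \<le> F"
    using cocoercive[of z "X k"] z gradient_at_solution by (simp add: G_def F_def)
  then have "2 * a * \<mu> * (G / (2 * L)) \<le> 2 * a * \<mu> * F"
    by (intro mult_left_mono mult_nonneg_nonneg less_imp_le[OF a_pos] mu_nonneg) auto
  moreover have "a\<^sup>2 * G - 2 * (a * (F + G / (2 * L))) = 2 * a * \<mu> * (G / (2 * L)) - 2 * a * F"
    using L_pos by (simp add: field_simps power2_eq_square)
  moreover have "2 * a * F - 2 * a * \<mu> * F = rate * F"
    using L_pos by (simp add: rate_def field_simps power2_eq_square)
  ultimately have 4: "a\<^sup>2 * G - 2 * (a * (F + G / (2 * L))) \<le> - (rate * F)" by linarith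
  \<comment> \<open>With the products as atoms, the four bounds combine linearly.\<close>
  have "N + 2 * (u - v) + (r + s) \<le> N - t"
    if "u \<le> w" "y \<le> v" "r + 2 * w \<le> 0" "s - 2 * y \<le> - t" for N u v w y r s t :: real
    using that by argo
  from this[OF 1 2 3 4] show ?thesis
    unfolding expand F_def[symmetric] .
qed

lemma dist_decrease: "norm (X (Suc k) - z) \<le> norm (X k - z)"
proof -
  have "0 \<le> rate * (f (X k) - f_star)" using rate_pos f_star_le[of "X k"] by simp
  then have "(norm (X (Suc k) - z))\<^sup>2 \<le> (norm (X k - z))\<^sup>2" using sq_dist_decrease[of k] by linarith
  then show ?thesis by (rule power2_le_imp_le) simp
qed

text \<open>Summing the decrease over all steps telescopes.\<close>

lemma values_converge: "(\<lambda>k. f (X k)) \<longlonglongrightarrow> f_star"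
proof -
  have "summable (\<lambda>k. rate * (f (X k) - f_star))"
  proof (rule summableI_nonneg_bounded)
    show "0 \<le> rate * (f (X n) - f_star)" for n
      using rate_pos f_star_le[of "X n"] by simp
    show "(\<Sum>k<n. rate * (f (X k) - f_star)) \<le> (norm (X 0 - z))\<^sup>2" for n
    proof -
      have "(\<Sum>k<n. rate * (f (X k) - f_star)) \<le> (norm (X 0 - z))\<^sup>2 - (norm (X n - z))\<^sup>2"
      proof (induction n)
        case (Suc n)
        then show ?case using sq_dist_decrease[of n] by simp
      qed simp
      then show ?thesis by (smt (verit) zero_le_power2)
    qed
  qed
  then have "(\<lambda>k. rate * (f (X k) - f_star)) \<longlonglongrightarrow> 0" by (rule summable_LIMSEQ_zero)
  from tendsto_mult[OF tendsto_const[of "inverse rate"] this]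
  have "(\<lambda>k. f (X k) - f_star) \<longlonglongrightarrow> 0"
    using rate_pos by (simp add: mult.assoc[symmetric])
  then show ?thesis by (simp add: LIM_zero_iff)
qed

end

end

section \<open>Fejer monotone sequences\<close>

lemma fejer_cluster_point_limit:
  fixes x :: "nat \<Rightarrow> 'a::real_normed_vector"
  assumes dec: "\<And>k. norm (x (Suc k) - z) \<le> norm (x k - z)"
    and sub: "strict_mono r" "(x \<circ> r) \<longlonglongrightarrow> z"
  shows "x \<longlonglongrightarrow> z"
proof -
  have dec: "decseq (\<lambda>k. norm (x k - z))" using dec by (rule decseq_SucI)
  then obtain l where l: "(\<lambda>k. norm (x k - z)) \<longlonglongrightarrow> l"
    by (rule decseq_convergent[where B = 0]) auto
  have "((\<lambda>k. norm (x k - z)) \<circ> r) \<longlonglongrightarrow> l" by (rule LIMSEQ_subseq_LIMSEQ[OF l sub(1)])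
  moreover have "((\<lambda>k. norm (x k - z)) \<circ> r) \<longlonglongrightarrow> 0"
    using sub(2) by (simp add: o_def LIM_zero_iff tendsto_norm_zero_iff)
  ultimately have "l = 0" by (rule LIMSEQ_unique)
  with l show ?thesis by (simp add: tendsto_norm_zero_iff LIM_zero_iff)
qed

text \<open>The limit is at most as far from a point of \<open>S\<close> as any iterate, so passing through a nearly
  closest point of \<open>S\<close> costs only a factor of two.\<close>

lemma fejer_dist_limit_le:
  fixes x :: "nat \<Rightarrow> 'a::real_normed_vector"
  assumes dec: "\<And>z k. z \<in> S \<Longrightarrow> norm (x (Suc k) - z) \<le> norm (x k - z)"
    and lim: "x \<longlonglongrightarrow> z0" and ne: "S \<noteq> {}"
  shows "norm (x k - z0) \<le> 2 * infdist (x k) S"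
proof -
  have "norm (x k - z0) / 2 \<le> dist (x k) z" if z: "z \<in> S" for z
  proof -
    have "decseq (\<lambda>k. norm (x k - z))" using dec[OF z] by (rule decseq_SucI)
    moreover have "(\<lambda>k. norm (x k - z)) \<longlonglongrightarrow> norm (z0 - z)"
      by (intro tendsto_intros lim)
    ultimately have "norm (z0 - z) \<le> norm (x k - z)" by (rule decseq_ge)
    moreover have "norm (x k - z0) \<le> norm (x k - z) + norm (z0 - z)"
      by (metis norm_triangle_ineq4 diff_diff_eq2 diff_add_cancel)
    ultimately show ?thesis by (simp add: dist_norm)
  qed
  then have "norm (x k - z0) / 2 \<le> infdist (x k) S"
    unfolding infdist_notempty[OF ne] by (intro cINF_greatest ne)
  then show ?thesis by simp
qed

section \<open>A rate for superlinear decrease\<close>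

text \<open>Since \<open>1 - t \<le> exp (-t)\<close>, one step multiplies \<open>D\<^sub>k\<close> by at most \<open>exp (- q D\<^sub>k\<^bsup>p\<^esup>)\<close>. Hence
  \<open>D\<^sub>k\<^bsup>-p\<^esup>\<close> is multiplied by at least \<open>exp (p q D\<^sub>k\<^bsup>p\<^esup>) \<ge> 1 + p q D\<^sub>k\<^bsup>p\<^esup>\<close>, that is, it increases by at
  least \<open>p q\<close>.\<close>

lemma power_decrease_step:
  fixes D D' p q :: real
  assumes p: "p > 0" and D: "D \<ge> 0" and D': "D' > 0" and dec: "D' \<le> D - q * D powr (1 + p)"
  shows "D > 0" and "D powr (- p) + p * q \<le> D' powr (- p)"
proof -
  show D_pos: "D > 0" using D D' dec by (cases "D = 0") auto
  define t where "t = q * D powr p"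
  have "D' \<le> D * (1 - t)"
    using dec D_pos by (simp add: t_def powr_add algebra_simps)
  also have "\<dots> \<le> D * exp (- t)"
    using D_pos exp_ge_add_one_self[of "- t"] by (intro mult_left_mono) auto
  finally have le: "D' \<le> D * exp (- t)" .
  have "D powr (- p) + p * q = D powr (- p) * (1 + p * t)"
    using D_pos by (simp add: t_def algebra_simps powr_minus)
  also have "\<dots> \<le> D powr (- p) * exp (p * t)"
    using exp_ge_add_one_self by (intro mult_left_mono) auto
  also have "\<dots> = (D * exp (- t)) powr (- p)"
    using D_pos by (simp add: powr_mult) (simp add: powr_def)
  also have "\<dots> \<le> D' powr (- p)"
    using le D' p by (intro powr_mono2') auto
  finally show "D powr (- p) + p * q \<le> D' powr (- p)" .
qed

lemma power_decrease_rate: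
  fixes D :: "nat \<Rightarrow> real"
  assumes p: "p > 0" and q: "q > 0" and nonneg: "\<And>k. D k \<ge> 0"
    and dec: "\<And>k. D (Suc k) \<le> D k - q * D k powr (1 + p)"
  shows "\<exists>C>0. \<forall>k. D k \<le> C * real (k + 1) powr (- (1 / p))"
proof -
  \<comment> \<open>If \<open>D 0 = 0\<close> then all \<open>D k\<close> vanish, and any positive constant will do.\<close>
  define c where "c = (if D 0 = 0 then p * q else min (D 0 powr (- p)) (p * q))"
  have c: "c > 0" "c \<le> p * q" using p q by (auto simp: c_def)
  have growth: "c * real (k + 1) \<le> D k powr (- p)" if "D k > 0" for k
    using that
  proof (induction k)
    case 0
    then show ?case by (simp add: c_def)
  next
    case (Suc k)
    note step = power_decrease_step[OF p nonneg Suc.prems dec]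
    have "c * real (Suc k + 1) = c * real (k + 1) + c" by (simp add: algebra_simps)
    also have "\<dots> \<le> D k powr (- p) + p * q" using Suc.IH[OF step(1)] c(2) by linarith
    also have "\<dots> \<le> D (Suc k) powr (- p)" by (rule step(2))
    finally show ?case .
  qed
  have "D k \<le> c powr (- (1 / p)) * real (k + 1) powr (- (1 / p))" for k
  proof (cases "D k = 0")
    case False
    then have Dk: "D k > 0" using nonneg[of k] by linarith
    have "D k = (D k powr (- p)) powr (- (1 / p))"
      using Dk p by (simp add: powr_powr)
    also have "\<dots> \<le> (c * real (k + 1)) powr (- (1 / p))"
      using growth[OF Dk] c(1) p by (intro powr_mono2') auto
    finally show ?thesis using c(1) by (simp add: powr_mult)
  qed simp
  then show ?thesis using c(1) by (intro exI[of _ "c powr (- (1 / p))"]) auto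
qed

section \<open>Convergence and rates\<close>

theorem theorem4p4:
  fixes f :: "real ^ 'd \<Rightarrow> real" and grad_f :: "real ^ 'd \<Rightarrow> real ^ 'd"
    and L f_star \<mu>0 :: real and \<beta> :: ereal
    and S :: "(real ^ 'd) set" and x0 :: "real ^ 'd" and x :: "nat \<Rightarrow> real ^ 'd"
  assumes convex: "convex_on UNIV f"
    and gradient: "\<And>y. GDERIV f y :> grad_f y"
    and cont_gradient: "continuous_on UNIV grad_f"
    and L_pos: "L > 0"
    and lipschitz: "\<And>y z. norm (grad_f y - grad_f z) \<le> L * norm (y - z)"
    and S_def: "S = {z. is_arg_min f (\<lambda>_. True) z}"
    and S_nonempty: "S \<noteq> {}"
    and f_star_attained: "f_star \<in> range f"
    and f_star_least: "\<And>y. f_star \<le> f y"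
    and beta_pos: "0 < \<beta>"
    and mu0: "0 \<le> \<mu>0" "\<mu>0 < 1"
    and x_def: "x = ahb_x f grad_f L f_star \<mu>0 \<beta> x0"
  shows "\<exists>xd \<in> S.
    ((\<lambda>k. norm (x k - xd)) \<longlonglongrightarrow> 0) \<and>
    (\<forall>(\<kappa>::real) (\<alpha>::real) (R::real).
       \<kappa> > 0 \<longrightarrow> \<alpha> \<ge> 2 \<longrightarrow>
       (\<forall>k. norm (x k - xd) < R) \<longrightarrow>
       (\<forall>y \<in> ball xd R. \<kappa> * (infdist y S) powr \<alpha> \<le> f y - f_star) \<longrightarrow>
       (\<alpha> = 2 \<longrightarrow>
          (\<forall>k. (norm (x (k + 1) - xd))\<^sup>2
                \<le> (1 - (1 - \<mu>0\<^sup>2) * \<kappa> / (4 * L)) * (norm (x k - xd))\<^sup>2)) \<and>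
       (\<alpha> > 2 \<longrightarrow>
          (\<exists>C > 0. \<forall>k. norm (x k - xd) \<le> C * real (k + 1) powr (- (1 / (\<alpha> - 2))))))"
proof -
  interpret adaptive_heavy_ball f grad_f L f_star \<mu>0 \<beta> x0
    using convex gradient L_pos lipschitz f_star_least beta_pos mu0 by unfold_locales
  obtain z1 where z1: "f z1 = f_star" using f_star_attained by auto
  have "is_arg_min f (\<lambda>_. True) z \<longleftrightarrow> f z = f_star" for z
    unfolding is_arg_min_linorder using f_star_least z1 by (metis order.antisym)
  then have S: "S = {z. f z = f_star}" by (simp add: S_def)
  have dec: "norm (x (Suc k) - z) \<le> norm (x k - z)" if "z \<in> S" for z k
    using dist_decrease[of z k] that unfolding S x_def by simp
  have sq_dec: "(norm (x (Suc k) - z))\<^sup>2 \<le> (norm (x k - z))\<^sup>2 - rate * (f (x k) - f_star)"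
    if "z \<in> S" for z k
    using sq_dist_decrease[of z k] that unfolding S x_def by simp
  obtain xd where xd: "xd \<in> S" and lim: "x \<longlonglongrightarrow> xd"
  proof -
    have "x k \<in> cball z1 (norm (x 0 - z1))" for k
      using decseqD[OF decseq_SucI[of "\<lambda>k. norm (x k - z1)"], of 0 k] dec z1
      by (simp add: S dist_norm norm_minus_commute)
    then obtain xd r where r: "strict_mono r" "(x \<circ> r) \<longlonglongrightarrow> xd"
      using compact_cball[of z1 "norm (x 0 - z1)"] unfolding compact_def by blast
    have "(f \<circ> (x \<circ> r)) \<longlonglongrightarrow> f xd"
      using isCont_tendsto_compose[OF cont_f r(2)] by (simp add: o_def)
    moreover have "((\<lambda>k. f (x k)) \<circ> r) \<longlonglongrightarrow> f_star"
      using LIMSEQ_subseq_LIMSEQ[OF values_converge[OF z1] r(1)] unfolding x_def .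
    ultimately have "f xd = f_star" using LIMSEQ_unique by (auto simp: o_def)
    then have "xd \<in> S" by (simp add: S)
    then show thesis using that fejer_cluster_point_limit[OF dec r] by blast
  qed
  have rates: "(\<alpha> = 2 \<longrightarrow>
          (\<forall>k. (norm (x (k + 1) - xd))\<^sup>2
                \<le> (1 - (1 - \<mu>0\<^sup>2) * \<kappa> / (4 * L)) * (norm (x k - xd))\<^sup>2)) \<and>
       (\<alpha> > 2 \<longrightarrow>
          (\<exists>C > 0. \<forall>k. norm (x k - xd) \<le> C * real (k + 1) powr (- (1 / (\<alpha> - 2)))))"
    if kappa: "\<kappa> > 0" and alpha: "\<alpha> \<ge> 2" and R: "\<forall>k. norm (x k - xd) < R"
      and bound: "\<forall>y \<in> ball xd R. \<kappa> * (infdist y S) powr \<alpha> \<le> f y - f_star"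
    for \<kappa> \<alpha> R :: real
  proof -
    define D where "D k = (norm (x k - xd))\<^sup>2" for k
    \<comment> \<open>The factor \<open>2 powr \<alpha>\<close> is the price of replacing \<open>d(x\<^sub>k, S)\<close> by half the distance to the limit.\<close>
    define q where "q = rate * \<kappa> / 2 powr \<alpha>"
    have q: "q > 0" using rate_pos kappa by (simp add: q_def)
    have decrease: "D (Suc k) \<le> D k - q * D k powr (\<alpha> / 2)" for k
    proof -
      have "norm (x k - xd) / 2 \<le> infdist (x k) S"
        using fejer_dist_limit_le[OF dec lim S_nonempty, of k] by simp
      then have "(norm (x k - xd) / 2) powr \<alpha> \<le> infdist (x k) S powr \<alpha>"
        using alpha by (intro powr_mono2) auto
      then have "\<kappa> * (norm (x k - xd) / 2) powr \<alpha> \<le> \<kappa> * infdist (x k) S powr \<alpha>"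
        using kappa by simp
      also have "\<dots> \<le> f (x k) - f_star"
        using bound R by (simp add: dist_norm norm_minus_commute)
      finally have "rate * (\<kappa> * (norm (x k - xd) / 2) powr \<alpha>) \<le> rate * (f (x k) - f_star)"
        using rate_pos by simp
      moreover have "rate * (\<kappa> * (norm (x k - xd) / 2) powr \<alpha>) = q * D k powr (\<alpha> / 2)"
      proof -
        have "D k = norm (x k - xd) powr 2"
          by (simp add: D_def)
        then have "D k powr (\<alpha> / 2) = norm (x k - xd) powr \<alpha>"
          by (simp only: powr_powr) simp
        then show ?thesis by (simp add: q_def powr_divide)
      qed
      ultimately show ?thesis using sq_dec[OF xd, of k] by (simp add: D_def)
    qed
    have "D (k + 1) \<le> (1 - (1 - \<mu>0\<^sup>2) * \<kappa> / (4 * L)) * D k" if "\<alpha> = 2" for k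
    proof -
      \<comment> \<open>The decrease estimate even gives the factor with \<open>2 * L\<close> in place of \<open>4 * L\<close>.\<close>
      define e where "e = (1 - \<mu>0\<^sup>2) * \<kappa> / (4 * L)"
      have "q = 2 * e"
        using that L_pos by (simp add: q_def rate_def e_def field_simps)
      then have "e * D k \<le> q * D k"
        using q by (intro mult_right_mono) (auto simp: D_def)
      moreover have "D k powr (\<alpha> / 2) = D k"
        using that by (simp add: D_def)
      ultimately show ?thesis
        using decrease[of k] unfolding e_def[symmetric] by (simp add: left_diff_distrib)
    qed
    moreover have "\<exists>C>0. \<forall>k. norm (x k - xd) \<le> C * real (k + 1) powr (- (1 / (\<alpha> - 2)))"
      if "\<alpha> > 2"
    proof -
      define p where "p = (\<alpha> - 2) / 2"
      have p: "p > 0" "\<alpha> / 2 = 1 + p" using that by (simp_all add: p_def field_simps)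
      have "D k \<ge> 0" for k by (simp add: D_def)
      then obtain C where C: "C > 0" "\<And>k. D k \<le> C * real (k + 1) powr (- (1 / p))"
        using power_decrease_rate[where D = D, OF p(1) q _ decrease[unfolded p(2)]] by blast
      have "norm (x k - xd) \<le> sqrt C * real (k + 1) powr (- (1 / (\<alpha> - 2)))" for k
      proof (rule power2_le_imp_le)
        have "(real (k + 1) powr (- (1 / (\<alpha> - 2))))\<^sup>2 = real (k + 1) powr (- (1 / p))"
          by (simp add: p_def powr_powr powr_power)
        then show "(norm (x k - xd))\<^sup>2 \<le> (sqrt C * real (k + 1) powr (- (1 / (\<alpha> - 2))))\<^sup>2"
          using C(1) C(2)[of k] by (simp add: power_mult_distrib D_def)
      qed (use C(1) in simp)
      then show ?thesis using C(1) by (intro exI[of _ "sqrt C"]) auto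
    qed
    ultimately show ?thesis by (auto simp: D_def)
  qed
  have "(\<lambda>k. norm (x k - xd)) \<longlonglongrightarrow> 0"
    using lim by (simp add: LIM_zero_iff tendsto_norm_zero_iff)
  with xd rates show ?thesis by blast
qed

end
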